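(* Let $k \geq 2$ and let $\Delta_k = \{\mathbf{x} \in \mathbb{R}^k : \mathbf{x} \geq 0,\ \sum_{i=1}^k x_i = 1\}$. For every Sperner-admissible partition $(A_1,\ldots,A_k)$ of $\Delta_k$, $$\mu^-_{k-2}\Big(\bigcup_{i \neq j} (A_i \cap A_j)\Big) \geq \frac{k-1}{\sqrt{2}}\, \mu_{k-1}(\Delta_k),$$ and the Voronoi partition $(A^*_1,\ldots,A^*_k)$, where $A^*_i = \{\mathbf{x} \in \Delta_k : x_i = \max_{1\le j \le k} x_j\}$, achieves this with equality.
   Context: A Sperner-admissible partition of $\Delta_k$ is a $k$-tuple of closed sets $(A_1,\ldots,A_k)$ such that $\bigcup_{i=1}^k A_i = \Delta_k$, the sets $A_1,\ldots,A_k$ are pairwise disjoint except on their boundaries, and $x_i > 0$ for every $\mathbf{x} \in A_i$. For $A \subset \mathbb{R}^k$ and $\ell < k$, with $A_\epsilon = \{\mathbf{y} \in \mathbb{R}^k : \exists \mathbf{x} \in A,\ \|\mathbf{x}-\mathbf{y}\| \leq \epsilon\}$ and $\alpha_{m}$ the volume of the unit ball in $\mathbb{R}^{m}$, the $\ell$-dimensional Minkowski content is $\mu_\ell(A) = \lim_{\epsilon\to 0^+} \mu_k(A_\epsilon)/(\alpha_{k-\ell}\epsilon^{k-\ell})$ when the limit exists, where $\mu_k$ is Lebesgue measure on $\mathbb{R}^k$; $\mu_\ell^-(A)$ denotes the corresponding lower limit (liminf). $\|\cdot\|$ is the Euclidean norm. *)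

theory Defs
  imports "HOL-Analysis.Analysis"
begin

text \<open>The dimension \<open>k\<close> is \<open>CARD('n)\<close>; the type \<open>'n\<close> indexes both the
  coordinates and the parts of a partition.\<close>

definition simplex_Delta :: "(real ^ 'n) set" where
  "simplex_Delta = {x. (\<forall>i. 0 \<le> x $ i) \<and> (\<Sum>i\<in>UNIV. x $ i) = 1}"

text \<open>Boundaries are taken in the subspace topology of the simplex: every subset of the simplex
  has empty interior in the ambient space, so the condition would be void there.\<close>

definition sperner_admissible :: "('n \<Rightarrow> (real ^ 'n) set) \<Rightarrow> bool" where
  "sperner_admissible A \<longleftrightarrow>
     (\<forall>i. closed (A i)) \<and>
     (\<Union>i. A i) = simplex_Delta \<and>
     (\<forall>i j. i \<noteq> j \<longrightarrow>
        A i \<inter> A j \<subseteq> (top_of_set simplex_Delta frontier_of A i)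
                 \<inter> (top_of_set simplex_Delta frontier_of A j)) \<and>
     (\<forall>i. \<forall>x\<in>A i. 0 < x $ i)"

definition separating_set :: "('n \<Rightarrow> (real ^ 'n) set) \<Rightarrow> (real ^ 'n) set" where
  "separating_set A = (\<Union>(i, j)\<in>{(i, j). i \<noteq> j}. A i \<inter> A j)"

definition voronoi :: "'n \<Rightarrow> (real ^ 'n) set" where
  "voronoi i = {x \<in> simplex_Delta. x $ i = (MAX j. x $ j)}"

definition eps_neighbourhood :: "real \<Rightarrow> (real ^ 'n) set \<Rightarrow> (real ^ 'n) set" where
  "eps_neighbourhood \<epsilon> A = {y. \<exists>x\<in>A. norm (x - y) \<le> \<epsilon>}"

text \<open>The definitions below are meaningful for \<open>l < CARD('n)\<close>. Values are extended
  nonnegative reals, since a lower content may be infinite.\<close>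

definition minkowski_quotient :: "nat \<Rightarrow> (real ^ 'n) set \<Rightarrow> real \<Rightarrow> ennreal" where
  "minkowski_quotient l A \<epsilon> =
     emeasure lebesgue (eps_neighbourhood \<epsilon> A) /
     ennreal (unit_ball_vol (real (CARD('n) - l)) * \<epsilon> ^ (CARD('n) - l))"

definition lower_minkowski_content :: "nat \<Rightarrow> (real ^ 'n) set \<Rightarrow> ennreal" where
  "lower_minkowski_content l A = Liminf (at_right 0) (minkowski_quotient l A)"

definition minkowski_content_exists :: "nat \<Rightarrow> (real ^ 'n) set \<Rightarrow> bool" where
  "minkowski_content_exists l A \<longleftrightarrow> (\<exists>m. (minkowski_quotient l A \<longlongrightarrow> m) (at_right 0))"

text \<open>Unspecified unless \<^const>\<open>minkowski_content_exists\<close> holds.\<close>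

definition minkowski_content :: "nat \<Rightarrow> (real ^ 'n) set \<Rightarrow> ennreal" where
  "minkowski_content l A = Lim (at_right 0) (minkowski_quotient l A)"

end

theory Submission imports Defs begin

text \<open>
  Let \<open>B\<close> be the separating set, \<open>c\<close> the centre of \<open>\<Delta>\<close>, \<open>e\<^sub>i\<close> its vertices, \<open>s = \<surd>2 r\<close> and
  \<open>\<nu>\<close> the \<open>(k - 1)\<close>-dimensional measure on the hyperplane of \<open>\<Delta>\<close>. A point of \<open>A i\<close> and a point
  of \<open>A j\<close> that both have distance more than \<open>r\<close> from \<open>B\<close> are more than \<open>2 r = \<parallel>s e\<^sub>i - s e\<^sub>j\<parallel>\<close>
  apart, because the segment between them meets \<open>B\<close>. Hence the sets \<open>A i - B\<^sub>r\<close>, translated by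
  \<open>s (c - e\<^sub>i)\<close>, are disjoint, and for small \<open>r\<close> positivity of \<open>x\<^sub>i\<close> on \<open>A i\<close> puts them into a copy of
  \<open>(1 - s) \<Delta>\<close>. So \<open>\<nu>(B\<^sub>r) \<ge> (1 - (1 - s)\<^sup>k\<^sup>-\<^sup>1) \<nu>(\<Delta>)\<close>, which is \<open>(k - 1) \<surd>2 r \<nu>(\<Delta>)\<close> to first order.

  For the Voronoi partition the opposite translations pack the cells of a copy of
  \<open>(1 + k r - s) \<Delta>\<close> into \<open>(1 + k r) \<Delta> - B\<^sub>r\<close>, up to a null set. As \<open>(1 + k r) \<Delta>\<close> contains
  \<open>B\<^sub>r\<close>, this gives a matching upper bound.

  Slicing the \<open>k\<close>-dimensional neighbourhood parallel to the hyperplane turns bounds \<open>K r\<close> on \<open>\<nu>(B\<^sub>r)\<close>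
  into the bound \<open>K\<close> times the area \<open>\<pi> \<epsilon>\<^sup>2 / 2\<close> of a half disc, so the quotient tends to \<open>K / 2\<close>.
\<close>

section \<open>The slice measure\<close>

definition diag :: "real ^ 'n" where
  "diag = (\<chi> i. 1 / sqrt (real CARD('n)))"

text \<open>Dividing by the norm of the all-ones vector makes this the signed Euclidean distance to
  the hyperplane of the simplex, whose unit normal is \<open>diag\<close>.\<close>

definition height :: "real ^ 'n \<Rightarrow> real" where
  "height x = ((\<Sum>i\<in>UNIV. x $ i) - 1) / sqrt (real CARD('n))"

definition flat_proj :: "real ^ 'n \<Rightarrow> real ^ 'n" where
  "flat_proj x = x - height x *\<^sub>R diag"

text \<open>The \<open>(k - 1)\<close>-dimensional measure on the hyperplane \<open>height x = 0\<close>, obtained as the volume of a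
  unit-height cylinder over a set. It ignores points off the hyperplane.\<close>

definition slice_measure :: "(real ^ 'n) measure" where
  "slice_measure = distr (density lborel (indicator {x. height x \<in> {0..1}})) borel flat_proj"

lemma norm_diag [simp]: "norm (diag :: real ^ 'n) = 1"
  by (simp add: norm_vec_def L2_set_def diag_def power_divide)

lemma inner_diag: "x \<bullet> (diag :: real ^ 'n) = (\<Sum>i\<in>UNIV. x $ i) / sqrt (real CARD('n))"
  by (simp add: inner_vec_def diag_def sum_divide_distrib)

lemma height_eq_0_iff: "height (x :: real ^ 'n) = 0 \<longleftrightarrow> (\<Sum>i\<in>UNIV. x $ i) = 1"
  by (simp add: height_def)

lemma height_add: "height (x + v) = height x + v \<bullet> diag"
  by (simp add: height_def inner_diag sum.distrib add_divide_distrib diff_divide_distrib)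

lemma height_shift [simp]: "height (x + t *\<^sub>R diag) = height x + t"
  by (simp add: height_add dot_square_norm)

lemma height_flat_proj [simp]: "height (flat_proj x) = 0"
  using height_shift[of x "- height x"] by (simp add: flat_proj_def)

lemma flat_proj_shift [simp]: "flat_proj (x + t *\<^sub>R diag) = flat_proj x"
  by (simp add: flat_proj_def algebra_simps)

lemma flat_proj_eq: "height x = 0 \<Longrightarrow> flat_proj x = x"
  by (simp add: flat_proj_def)

lemma flat_proj_add: "v \<bullet> diag = 0 \<Longrightarrow> flat_proj (x + v) = flat_proj x + v"
  by (simp add: flat_proj_def height_add)

lemma continuous_height [continuous_intros]:
  "continuous_on S f \<Longrightarrow> continuous_on S (\<lambda>x. height (f x))"
  unfolding height_def by (intro continuous_intros) auto

lemma measurable_height [measurable]: "height \<in> borel_measurable borel"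
  by (intro borel_measurable_continuous_onI continuous_intros)

lemma measurable_flat_proj [measurable]: "flat_proj \<in> borel_measurable borel"
  unfolding flat_proj_def by measurable

lemma sets_slice_measure [measurable_cong, simp]: "sets slice_measure = sets borel"
  and space_slice_measure [simp]: "space slice_measure = UNIV"
  by (simp_all add: slice_measure_def)

lemma nn_integral_slice_measure:
  assumes [measurable]: "f \<in> borel_measurable borel"
  shows "(\<integral>\<^sup>+ x. f x \<partial>slice_measure) =
    (\<integral>\<^sup>+ x. indicator {0..1} (height x) * f (flat_proj x) \<partial>lborel)"
proof -
  have "(\<integral>\<^sup>+ x. f x \<partial>slice_measure) =
    (\<integral>\<^sup>+ x. indicator {x. height x \<in> {0..1}} x * f (flat_proj x) \<partial>lborel)"
    unfolding slice_measure_def by (simp add: nn_integral_distr nn_integral_density)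
  then show ?thesis by (simp add: indicator_def)
qed

lemma emeasure_slice_measure:
  assumes [measurable]: "S \<in> sets borel"
  shows "emeasure slice_measure S = emeasure lborel {x. height x \<in> {0..1} \<and> flat_proj x \<in> S}"
proof -
  have "emeasure slice_measure S = (\<integral>\<^sup>+ x. indicator S x \<partial>slice_measure)"
    by simp
  also have "\<dots> = (\<integral>\<^sup>+ x. indicator {x. height x \<in> {0..1} \<and> flat_proj x \<in> S} x \<partial>lborel)"
    unfolding nn_integral_slice_measure[OF borel_measurable_indicator[OF assms]]
    by (rule nn_integral_cong) (simp add: indicator_def)
  also have "\<dots> = emeasure lborel {x. height x \<in> {0..1} \<and> flat_proj x \<in> S}"
    by (rule nn_integral_indicator) measurable
  finally show ?thesis .
qed

text \<open>All values of \<open>flat_proj\<close> lie on the hyperplane, so only points of height 0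
  have to be compared. This matters for neighbourhoods, which also contain points off the
  hyperplane.\<close>

lemma emeasure_slice_measure_mono:
  assumes "\<And>x. height x = 0 \<Longrightarrow> x \<in> S \<Longrightarrow> x \<in> S'" "S \<in> sets borel" "S' \<in> sets borel"
  shows "emeasure slice_measure S \<le> emeasure slice_measure S'"
proof -
  note [measurable] = assms(2,3)
  show ?thesis
    unfolding emeasure_slice_measure[OF assms(2)] emeasure_slice_measure[OF assms(3)]
    by (rule emeasure_mono) (auto intro: assms(1))
qed

lemma emeasure_slice_measure_cong:
  assumes "\<And>x. height x = 0 \<Longrightarrow> x \<in> S \<longleftrightarrow> x \<in> S'" "S \<in> sets borel" "S' \<in> sets borel"
  shows "emeasure slice_measure S = emeasure slice_measure S'"
  using assms by (intro antisym emeasure_slice_measure_mono) auto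

section \<open>Fubini along the normal direction\<close>

lemma nn_integral_lborel_translate:
  fixes f :: "'a::euclidean_space \<Rightarrow> ennreal"
  assumes [measurable]: "f \<in> borel_measurable borel"
  shows "(\<integral>\<^sup>+ x. f (x + c) \<partial>lborel) = (\<integral>\<^sup>+ x. f x \<partial>lborel)"
proof -
  have "(\<integral>\<^sup>+ x. f x \<partial>lborel) = (\<integral>\<^sup>+ x. f x \<partial>distr lborel borel ((+) c))"
    by (simp only: lborel_distr_plus)
  also have "\<dots> = (\<integral>\<^sup>+ x. f (c + x) \<partial>lborel)"
    by (subst nn_integral_distr) auto
  finally show ?thesis by (simp add: add.commute)
qed

text \<open>Cavalieri's principle for slices orthogonal to \<open>diag\<close>, without a rotation
  of coordinates. The slice measure is unfolded to an integral over the unit-height slab, and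
  Tonelli's theorem with translation invariance moves the dependence on \<open>t\<close> from
  \<open>E\<close> to the slab.\<close>

lemma emeasure_lborel_slices:
  fixes E :: "(real ^ 'n) set"
  assumes E [measurable]: "E \<in> sets borel"
  shows "emeasure lborel E = (\<integral>\<^sup>+ t. emeasure slice_measure {y. y + t *\<^sub>R diag \<in> E} \<partial>lborel)"
proof -
  let ?I = "indicator {0..1} :: real \<Rightarrow> ennreal"
  let ?E = "indicator E :: real ^ 'n \<Rightarrow> ennreal"
  let ?d = "diag :: real ^ 'n"
  have "(\<integral>\<^sup>+ t. emeasure slice_measure {y. y + t *\<^sub>R ?d \<in> E} \<partial>lborel)
      = (\<integral>\<^sup>+ t. \<integral>\<^sup>+ x. ?I (height x) * ?E (flat_proj x + t *\<^sub>R ?d) \<partial>lborel \<partial>lborel)"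
  proof (rule nn_integral_cong)
    fix t
    have "emeasure slice_measure {y. y + t *\<^sub>R ?d \<in> E}
        = (\<integral>\<^sup>+ x. indicator {y. y + t *\<^sub>R ?d \<in> E} x \<partial>slice_measure)"
      by (subst nn_integral_indicator) auto
    also have "\<dots> = (\<integral>\<^sup>+ x. ?E (x + t *\<^sub>R ?d) \<partial>slice_measure)"
      by (rule nn_integral_cong) (simp add: indicator_def)
    also have "\<dots> = (\<integral>\<^sup>+ x. ?I (height x) * ?E (flat_proj x + t *\<^sub>R ?d) \<partial>lborel)"
      by (subst nn_integral_slice_measure) auto
    finally show "emeasure slice_measure {y. y + t *\<^sub>R ?d \<in> E} = \<dots>" .
  qed
  also have "\<dots> = (\<integral>\<^sup>+ x. \<integral>\<^sup>+ t. ?I (height x) * ?E (flat_proj x + t *\<^sub>R ?d) \<partial>lborel \<partial>lborel)"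
    by (rule lborel_pair.Fubini') measurable
  \<comment> \<open>Shifting \<open>t\<close> by \<open>height x\<close> undoes the projection
    inside \<open>E\<close>.\<close>
  also have "\<dots> = (\<integral>\<^sup>+ x. \<integral>\<^sup>+ t. ?I (height x) * ?E (x + t *\<^sub>R ?d) \<partial>lborel \<partial>lborel)"
  proof (rule nn_integral_cong)
    fix x :: "real ^ 'n"
    have "(\<integral>\<^sup>+ t. ?I (height x) * ?E (x + (t + (- height x)) *\<^sub>R ?d) \<partial>lborel)
        = (\<integral>\<^sup>+ t. ?I (height x) * ?E (x + t *\<^sub>R ?d) \<partial>lborel)"
      by (rule nn_integral_lborel_translate[where f = "\<lambda>t. ?I (height x) * ?E (x + t *\<^sub>R ?d)"])
        measurable
    then show "(\<integral>\<^sup>+ t. ?I (height x) * ?E (flat_proj x + t *\<^sub>R ?d) \<partial>lborel)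
        = (\<integral>\<^sup>+ t. ?I (height x) * ?E (x + t *\<^sub>R ?d) \<partial>lborel)"
      by (simp add: flat_proj_def algebra_simps)
  qed
  also have "\<dots> = (\<integral>\<^sup>+ t. \<integral>\<^sup>+ x. ?I (height x) * ?E (x + t *\<^sub>R ?d) \<partial>lborel \<partial>lborel)"
    by (rule lborel_pair.Fubini') measurable
  \<comment> \<open>Shifting \<open>x\<close> by a multiple of \<open>diag\<close> frees
    \<open>E\<close> from \<open>t\<close>; only the height window still moves.\<close>
  also have "\<dots> = (\<integral>\<^sup>+ t. \<integral>\<^sup>+ x. ?I (height x - t) * ?E x \<partial>lborel \<partial>lborel)"
  proof (rule nn_integral_cong)
    fix t
    have "(\<integral>\<^sup>+ x. ?I (height (x + t *\<^sub>R ?d) - t) * ?E (x + t *\<^sub>R ?d) \<partial>lborel)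
        = (\<integral>\<^sup>+ x. ?I (height x - t) * ?E x \<partial>lborel)"
      by (rule nn_integral_lborel_translate[where f = "\<lambda>x. ?I (height x - t) * ?E x"]) measurable
    then show "(\<integral>\<^sup>+ x. ?I (height x) * ?E (x + t *\<^sub>R ?d) \<partial>lborel)
        = (\<integral>\<^sup>+ x. ?I (height x - t) * ?E x \<partial>lborel)"
      by simp
  qed
  also have "\<dots> = (\<integral>\<^sup>+ x. \<integral>\<^sup>+ t. ?I (height x - t) * ?E x \<partial>lborel \<partial>lborel)"
    by (rule lborel_pair.Fubini') measurable
  \<comment> \<open>For fixed \<open>x\<close> the admissible \<open>t\<close> form an interval of
    length 1.\<close>
  also have "\<dots> = (\<integral>\<^sup>+ x. ?E x \<partial>lborel)"
  proof (rule nn_integral_cong)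
    fix x :: "real ^ 'n"
    have "(\<integral>\<^sup>+ t. ?I (height x - t) * ?E x \<partial>lborel)
        = (\<integral>\<^sup>+ t. indicator {height x - 1..height x} t * ?E x \<partial>lborel)"
      by (rule nn_integral_cong) (auto simp: indicator_def)
    also have "\<dots> = ?E x"
      by (subst nn_integral_multc) auto
    finally show "(\<integral>\<^sup>+ t. ?I (height x - t) * ?E x \<partial>lborel) = ?E x" .
  qed
  finally show ?thesis by simp
qed

lemma emeasure_slice_measure_translate:
  assumes [measurable]: "S \<in> sets borel" and v: "v \<bullet> diag = 0"
  shows "emeasure slice_measure ((\<lambda>x. x + v) -` S) = emeasure slice_measure S"
proof -
  have [measurable]: "(\<lambda>x. x + v) -` S \<in> sets borel"
    using measurable_sets_borel[of "\<lambda>x. x + v" borel S] by simp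
  have "emeasure slice_measure S = (\<integral>\<^sup>+ x. indicator {0..1} (height x) * indicator S (flat_proj x) \<partial>lborel)"
    by (subst nn_integral_slice_measure[symmetric]) auto
  also have "\<dots> = (\<integral>\<^sup>+ x. indicator {0..1} (height (x + v)) * indicator S (flat_proj (x + v)) \<partial>lborel)"
    by (rule nn_integral_lborel_translate
        [where f = "\<lambda>x. indicator {0..1} (height x) * indicator S (flat_proj x)", symmetric]) measurable
  also have "\<dots> = (\<integral>\<^sup>+ x. indicator {0..1} (height x) * indicator ((\<lambda>x. x + v) -` S) (flat_proj x) \<partial>lborel)"
    using v by (simp add: height_add flat_proj_add indicator_def)
  also have "\<dots> = emeasure slice_measure ((\<lambda>x. x + v) -` S)"
    by (subst nn_integral_slice_measure[symmetric]) auto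
  finally show ?thesis by simp
qed

lemma emeasure_cylinder:
  fixes S :: "(real ^ 'n) set"
  assumes [measurable]: "S \<in> sets borel" and "a \<le> b"
  shows "emeasure lborel {x. height x \<in> {a..b} \<and> flat_proj x \<in> S} = ennreal (b - a) * emeasure slice_measure S"
proof -
  have "emeasure slice_measure {y. y + t *\<^sub>R diag \<in> {x. height x \<in> {a..b} \<and> flat_proj x \<in> S}}
      = emeasure slice_measure S * indicator {a..b} t" for t :: real
  proof (cases "t \<in> {a..b}")
    case True
    then have "emeasure slice_measure {y. y + t *\<^sub>R diag \<in> {x. height x \<in> {a..b} \<and> flat_proj x \<in> S}}
       = emeasure slice_measure S"
      by (intro emeasure_slice_measure_cong) (auto simp: flat_proj_eq)
    with True show ?thesis by simp
  next
    case False
    then have "emeasure slice_measure {y. y + t *\<^sub>R diag \<in> {x. height x \<in> {a..b} \<and> flat_proj x \<in> S}}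
       = emeasure slice_measure ({} :: (real ^ 'n) set)"
      by (intro emeasure_slice_measure_cong) auto
    with False show ?thesis by simp
  qed
  then show ?thesis
    using \<open>a \<le> b\<close> by (subst emeasure_lborel_slices) (simp_all add: nn_integral_cmult mult.commute)
qed

text \<open>The homothetic image of the simplex with ratio \<open>a\<close> about its centre.\<close>

definition scaled_simplex :: "real \<Rightarrow> (real ^ 'n) set" where
  "scaled_simplex a = {x. height x = 0 \<and> (\<forall>i. (1 - a) / real CARD('n) \<le> x $ i)}"

lemma scaled_simplex_1: "scaled_simplex 1 = simplex_Delta"
  by (auto simp: scaled_simplex_def simplex_Delta_def height_eq_0_iff)

lemma closed_scaled_simplex: "closed (scaled_simplex a)"
  unfolding scaled_simplex_def
  by (intro closed_Collect_conj closed_Collect_eq closed_Collect_all closed_Collect_le continuous_intros)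

lemma scaled_simplex_borel [measurable]: "scaled_simplex a \<in> sets borel"
  by (intro borel_closed closed_scaled_simplex)

lemma closed_simplex_Delta: "closed (simplex_Delta :: (real ^ 'n) set)"
  using closed_scaled_simplex[of 1] by (simp add: scaled_simplex_1)

lemma simplex_Delta_borel [measurable, simp]: "simplex_Delta \<in> sets borel"
  by (intro borel_closed closed_simplex_Delta)

lemma emeasure_lborel_scale:
  fixes c :: "'a::euclidean_space"
  assumes [measurable]: "S \<in> sets borel" and "a > 0"
  shows "emeasure lborel S = ennreal (a ^ DIM('a)) * emeasure lborel ((\<lambda>x. c + a *\<^sub>R x) -` S)"
proof -
  have "emeasure lborel S = emeasure (density (distr lborel borel (\<lambda>x. c + a *\<^sub>R x)) (\<lambda>_. \<bar>a\<bar>^DIM('a))) S"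
    using lborel_affine[of a c] \<open>a > 0\<close> by simp
  also have "\<dots> = ennreal (a ^ DIM('a)) * emeasure lborel ((\<lambda>x. c + a *\<^sub>R x) -` S)"
    using \<open>a > 0\<close> by (subst emeasure_density_const) (simp_all add: emeasure_distr)
  finally show ?thesis .
qed

text \<open>The homothety of ratio \<open>a\<close> multiplies \<open>k\<close>-dimensional volume
  by \<open>a ^ k\<close> and carries the cylinder of height 1 over the simplex to the cylinder of
  height \<open>a\<close> over the image. Cancelling the height leaves the exponent
  \<open>k - 1\<close>.\<close>

lemma emeasure_scaled_simplex:
  assumes "a > 0"
  shows "emeasure slice_measure (scaled_simplex a :: (real ^ 'n) set)
    = ennreal (a ^ (CARD('n) - 1)) * emeasure slice_measure (simplex_Delta :: (real ^ 'n) set)"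
proof -
  let ?k = "real CARD('n)"
  \<comment> \<open>With this offset the map \<open>c + a *\<^sub>R x\<close> fixes the centre of
    the simplex.\<close>
  define c :: "real ^ 'n" where "c = (\<chi> i. (1 - a) / ?k)"
  have hc: "height (c + a *\<^sub>R x) = a * height x" for x
  proof -
    have "(\<Sum>i\<in>UNIV. (c + a *\<^sub>R x) $ i) - 1 = a * ((\<Sum>i\<in>UNIV. x $ i) - 1)"
      by (simp add: c_def sum.distrib sum_distrib_left[symmetric] right_diff_distrib diff_divide_distrib)
    then show ?thesis
      by (simp add: height_def)
  qed
  have pc: "flat_proj (c + a *\<^sub>R x) = c + a *\<^sub>R flat_proj x" for x
    by (simp add: flat_proj_def hc algebra_simps)
  have Tc: "c + a *\<^sub>R x \<in> scaled_simplex a \<longleftrightarrow> x \<in> scaled_simplex 1" for x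
    using \<open>a > 0\<close> by (simp add: scaled_simplex_def hc) (simp add: c_def zero_le_mult_iff)
  have "ennreal a * emeasure slice_measure (scaled_simplex a :: (real ^ 'n) set)
      = emeasure lborel {x. height x \<in> {0..a} \<and> flat_proj x \<in> (scaled_simplex a :: (real ^ 'n) set)}"
    using \<open>a > 0\<close> by (subst emeasure_cylinder) auto
  also have "\<dots> = ennreal (a ^ CARD('n)) * emeasure lborel
     ((\<lambda>x. c + a *\<^sub>R x) -` {x. height x \<in> {0..a} \<and> flat_proj x \<in> (scaled_simplex a :: (real ^ 'n) set)})"
    using \<open>a > 0\<close> by (subst emeasure_lborel_scale[where c = c and a = a]) auto
  also have "(\<lambda>x. c + a *\<^sub>R x) -` {x. height x \<in> {0..a} \<and> flat_proj x \<in> (scaled_simplex a :: (real ^ 'n) set)}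
     = {x. height x \<in> {0..1} \<and> flat_proj x \<in> (scaled_simplex 1 :: (real ^ 'n) set)}"
    using \<open>a > 0\<close> by (auto simp: hc pc Tc zero_le_mult_iff)
  also have "emeasure lborel \<dots> = emeasure slice_measure (simplex_Delta :: (real ^ 'n) set)"
    by (subst emeasure_slice_measure[symmetric]) (auto simp: scaled_simplex_1)
  also have "ennreal (a ^ CARD('n)) * \<dots>
     = ennreal a * (ennreal (a ^ (CARD('n) - 1)) * emeasure slice_measure (simplex_Delta :: (real ^ 'n) set))"
  proof -
    have "a ^ CARD('n) = a * a ^ (CARD('n) - 1)"
      by (simp add: power_eq_if)
    then show ?thesis
      using \<open>a > 0\<close> by (simp add: ennreal_mult mult.assoc)
  qed
  finally show ?thesis
    using \<open>a > 0\<close> by (simp add: ennreal_mult_cancel_left)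
qed

lemma bounded_simplex_Delta: "bounded (simplex_Delta :: (real ^ 'n) set)"
proof (rule boundedI)
  fix x :: "real ^ 'n" assume x: "x \<in> simplex_Delta"
  have "norm x \<le> (\<Sum>i\<in>UNIV. \<bar>x $ i\<bar>)"
    by (rule norm_le_l1_cart)
  also have "\<dots> = 1"
    using x by (simp add: simplex_Delta_def)
  finally show "norm x \<le> 1" .
qed

lemma compact_simplex_Delta: "compact (simplex_Delta :: (real ^ 'n) set)"
  by (simp add: compact_eq_bounded_closed bounded_simplex_Delta closed_simplex_Delta)

lemma emeasure_slice_simplex_finite:
  "emeasure slice_measure (simplex_Delta :: (real ^ 'n) set) < \<infinity>"
proof -
  obtain K where K: "\<And>x. x \<in> (simplex_Delta :: (real ^ 'n) set) \<Longrightarrow> norm x \<le> K"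
    using bounded_simplex_Delta by (auto simp: bounded_iff)
  have "emeasure slice_measure (simplex_Delta :: (real ^ 'n) set)
     = emeasure lborel {x. height x \<in> {0..1} \<and> flat_proj x \<in> (simplex_Delta :: (real ^ 'n) set)}"
    by (simp add: emeasure_slice_measure)
  also have "\<dots> \<le> emeasure lborel (cball (0 :: real ^ 'n) (K + 1))"
  proof (rule emeasure_mono)
    have "norm x \<le> K + 1" if "height x \<in> {0..1}" "flat_proj x \<in> simplex_Delta" for x :: "real ^ 'n"
    proof -
      have "norm x = norm (flat_proj x + height x *\<^sub>R diag)"
        by (simp add: flat_proj_def)
      also have "\<dots> \<le> norm (flat_proj x) + norm (height x *\<^sub>R (diag :: real ^ 'n))"
        by (rule norm_triangle_ineq)
      also have "\<dots> \<le> K + 1"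
        using that K[of "flat_proj x"] by simp
      finally show ?thesis .
    qed
    then show "{x. height x \<in> {0..1} \<and> flat_proj x \<in> (simplex_Delta :: (real ^ 'n) set)} \<subseteq> cball 0 (K + 1)"
      by auto
  qed simp
  also have "\<dots> < \<infinity>"
    by (metis emeasure_lborel_cball_finite)
  finally show ?thesis .
qed

section \<open>Neighbourhoods and Minkowski content\<close>

text \<open>The vertical slice of a disc at abscissa \<open>t\<close> is an interval of twice the
  integrand's length, so twice the integral is the area of the disc.\<close>

lemma nn_integral_half_disc:
  assumes "\<epsilon> \<ge> 0"
  shows "(\<integral>\<^sup>+ t. ennreal (sqrt (\<epsilon>\<^sup>2 - t\<^sup>2)) * indicator {-\<epsilon>..\<epsilon>} t \<partial>lborel) = ennreal (pi * \<epsilon>\<^sup>2 / 2)"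
    (is "?I = _")
proof -
  have slice: "emeasure lborel (Pair t -` cball (0 :: real \<times> real) \<epsilon>)
      = 2 * (ennreal (sqrt (\<epsilon>\<^sup>2 - t\<^sup>2)) * indicator {-\<epsilon>..\<epsilon>} t)" for t
  proof (cases "t \<in> {-\<epsilon>..\<epsilon>}")
    case True
    then have t: "t\<^sup>2 \<le> \<epsilon>\<^sup>2"
      by (intro abs_le_square_iff[THEN iffD1]) auto
    have "Pair t -` cball (0 :: real \<times> real) \<epsilon> = {- sqrt (\<epsilon>\<^sup>2 - t\<^sup>2)..sqrt (\<epsilon>\<^sup>2 - t\<^sup>2)}"
    proof -
      have "norm (t, u) \<le> \<epsilon> \<longleftrightarrow> \<bar>u\<bar> \<le> sqrt (\<epsilon>\<^sup>2 - t\<^sup>2)" for u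
      proof -
        have "norm (t, u) \<le> \<epsilon> \<longleftrightarrow> t\<^sup>2 + u\<^sup>2 \<le> \<epsilon>\<^sup>2"
          using \<open>\<epsilon> \<ge> 0\<close> by (simp add: norm_Pair real_sqrt_le_iff')
        also have "\<dots> \<longleftrightarrow> \<bar>u\<bar> \<le> sqrt (\<epsilon>\<^sup>2 - t\<^sup>2)"
          by (metis add.commute le_diff_eq real_sqrt_abs real_sqrt_le_iff)
        finally show ?thesis .
      qed
      then show ?thesis by (auto simp: mem_cball abs_le_iff simp flip: zero_prod_def)
    qed
    with True t show ?thesis by (simp add: ennreal_mult)
  next
    case False
    have "Pair t -` cball (0 :: real \<times> real) \<epsilon> = {}"
    proof -
      have "\<epsilon> < norm (t, u)" for u :: real
        using False norm_fst_le[of t u] by auto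
      then show ?thesis by (auto simp: not_le[symmetric] simp flip: zero_prod_def)
    qed
    with False show ?thesis by simp
  qed
  have "ennreal (pi * \<epsilon>\<^sup>2) = emeasure lborel (cball (0 :: real \<times> real) \<epsilon>)"
    using \<open>\<epsilon> \<ge> 0\<close> by (subst emeasure_cball) (auto simp: unit_ball_vol_numeral power2_eq_square)
  also have "\<dots> = (\<integral>\<^sup>+ t. emeasure lborel (Pair t -` cball (0 :: real \<times> real) \<epsilon>) \<partial>lborel)"
  proof -
    have "cball (0 :: real \<times> real) \<epsilon> \<in> sets (lborel \<Otimes>\<^sub>M lborel)"
      unfolding lborel_prod by simp
    from lborel.emeasure_pair_measure_alt[OF this] show ?thesis
      unfolding lborel_prod .
  qed
  also have "\<dots> = 2 * ?I"
    unfolding slice by (rule nn_integral_cmult) measurable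
  finally have *: "2 * ?I = ennreal (pi * \<epsilon>\<^sup>2)" ..
  have "2 * ?I = 2 * ennreal (pi * \<epsilon>\<^sup>2 / 2)"
    unfolding * by (subst ennreal_numeral[symmetric], subst ennreal_mult[symmetric]) auto
  then show ?thesis by (simp add: ennreal_mult_cancel_left)
qed

section \<open>Slices of neighbourhoods\<close>

lemma compact_eps_neighbourhood:
  fixes B :: "(real ^ 'n) set"
  assumes "compact B"
  shows "compact (eps_neighbourhood \<epsilon> B)"
proof -
  have "eps_neighbourhood \<epsilon> B = {x + y |x y. x \<in> B \<and> y \<in> cball 0 \<epsilon>}"
  proof (intro set_eqI iffI)
    fix y assume "y \<in> eps_neighbourhood \<epsilon> B"
    then obtain b where "b \<in> B" "norm (b - y) \<le> \<epsilon>"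
      by (auto simp: eps_neighbourhood_def)
    then have "y = b + (y - b)" "b \<in> B" "y - b \<in> cball 0 \<epsilon>"
      by (auto simp: norm_minus_commute)
    then show "y \<in> {x + y |x y. x \<in> B \<and> y \<in> cball 0 \<epsilon>}" by blast
  qed (force simp: eps_neighbourhood_def)
  then show ?thesis
    using compact_sums[OF assms compact_cball[of 0 \<epsilon>]] by simp
qed

lemma eps_neighbourhood_borel:
  "compact B \<Longrightarrow> eps_neighbourhood \<epsilon> B \<in> sets borel"
  by (intro borel_closed compact_imp_closed compact_eps_neighbourhood)

lemma emeasure_lebesgue_eps_neighbourhood:
  assumes "compact B"
  shows "emeasure lebesgue (eps_neighbourhood \<epsilon> B) = emeasure lborel (eps_neighbourhood \<epsilon> B)"
  using eps_neighbourhood_borel[OF assms, of \<epsilon>] by (subst emeasure_completion) auto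

text \<open>Pythagoras: \<open>b - y\<close> is parallel to the hyperplane, hence orthogonal to
  \<open>diag\<close>. So each slice of a neighbourhood is again a neighbourhood, of smaller
  radius.\<close>

lemma eps_neighbourhood_slice:
  assumes B: "\<And>b. b \<in> B \<Longrightarrow> height b = 0" and y: "height y = 0" and "\<epsilon> \<ge> 0"
  shows "y + t *\<^sub>R diag \<in> eps_neighbourhood \<epsilon> B \<longleftrightarrow>
    t \<in> {-\<epsilon>..\<epsilon>} \<and> y \<in> eps_neighbourhood (sqrt (\<epsilon>\<^sup>2 - t\<^sup>2)) B"
proof -
  have *: "norm (b - (y + t *\<^sub>R diag)) \<le> \<epsilon> \<longleftrightarrow> t \<in> {-\<epsilon>..\<epsilon>} \<and> norm (b - y) \<le> sqrt (\<epsilon>\<^sup>2 - t\<^sup>2)"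
    if "b \<in> B" for b
  proof -
    have orth: "(b - y) \<bullet> diag = 0"
      using height_add[of y "b - y"] y B[OF that] by simp
    have eq: "(norm (b - (y + t *\<^sub>R diag)))\<^sup>2 = (norm (b - y))\<^sup>2 + t\<^sup>2"
      using norm_add_Pythagorean[of "b - y" "(- t) *\<^sub>R diag"] orth
      by (simp add: orthogonal_def algebra_simps)
    have "norm (b - (y + t *\<^sub>R diag)) \<le> \<epsilon> \<longleftrightarrow> (norm (b - y))\<^sup>2 + t\<^sup>2 \<le> \<epsilon>\<^sup>2"
      using \<open>\<epsilon> \<ge> 0\<close> unfolding eq[symmetric] by (simp add: power_mono_iff)
    also have "\<dots> \<longleftrightarrow> t\<^sup>2 \<le> \<epsilon>\<^sup>2 \<and> norm (b - y) \<le> sqrt (\<epsilon>\<^sup>2 - t\<^sup>2)"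
      by (smt (verit) real_le_rsqrt real_sqrt_ge_zero real_sqrt_le_iff norm_ge_zero
          real_sqrt_unique sqrt_le_D zero_le_power2 real_sqrt_pow2 power_mono)
    also have "t\<^sup>2 \<le> \<epsilon>\<^sup>2 \<longleftrightarrow> t \<in> {-\<epsilon>..\<epsilon>}"
      using \<open>\<epsilon> \<ge> 0\<close> abs_le_square_iff[of t \<epsilon>] by auto
    finally show ?thesis .
  qed
  show ?thesis
    unfolding eps_neighbourhood_def using * by auto
qed

lemma emeasure_eps_neighbourhood:
  fixes B :: "(real ^ 'n) set"
  assumes "compact B" and B: "\<And>b. b \<in> B \<Longrightarrow> height b = 0" and "\<epsilon> \<ge> 0"
  shows "emeasure lebesgue (eps_neighbourhood \<epsilon> B) =
    (\<integral>\<^sup>+ t. emeasure slice_measure (eps_neighbourhood (sqrt (\<epsilon>\<^sup>2 - t\<^sup>2)) B) * indicator {-\<epsilon>..\<epsilon>} t \<partial>lborel)"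
proof -
  note [measurable] = eps_neighbourhood_borel[OF \<open>compact B\<close>]
  have "emeasure slice_measure {y. y + t *\<^sub>R diag \<in> eps_neighbourhood \<epsilon> B}
     = emeasure slice_measure (eps_neighbourhood (sqrt (\<epsilon>\<^sup>2 - t\<^sup>2)) B) * indicator {-\<epsilon>..\<epsilon>} t" for t
  proof -
    have "emeasure slice_measure {y. y + t *\<^sub>R diag \<in> eps_neighbourhood \<epsilon> B}
      = emeasure slice_measure (if t \<in> {-\<epsilon>..\<epsilon>} then eps_neighbourhood (sqrt (\<epsilon>\<^sup>2 - t\<^sup>2)) B else {})"
      using B \<open>\<epsilon> \<ge> 0\<close>
      by (intro emeasure_slice_measure_cong) (auto simp: eps_neighbourhood_slice)
    then show ?thesis by simp
  qed
  then show ?thesis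
    using \<open>compact B\<close> by (simp add: emeasure_lebesgue_eps_neighbourhood emeasure_lborel_slices)
qed

lemma minkowski_quotient_codim_2:
  assumes "CARD('n) \<ge> 2"
  shows "minkowski_quotient (CARD('n) - 2) (B :: (real ^ 'n) set) \<epsilon>
    = emeasure lebesgue (eps_neighbourhood \<epsilon> B) / ennreal (pi * \<epsilon>\<^sup>2)"
  using assms by (simp add: minkowski_quotient_def unit_ball_vol_numeral)

text \<open>Integrating a linear bound over the slices gives \<open>K\<close> times the area of a
  half disc. Only radii up to \<epsilon> are involved, so \<open>K\<close> may depend on \<epsilon>;
  this later absorbs the terms of higher order in \<open>r\<close>.\<close>

lemma
  fixes B :: "(real ^ 'n) set"
  assumes "CARD('n) \<ge> 2" "compact B" "\<And>b. b \<in> B \<Longrightarrow> height b = 0" "\<epsilon> > 0" "K \<ge> 0"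
  shows minkowski_quotient_geI:
      "(\<And>r. 0 \<le> r \<Longrightarrow> r \<le> \<epsilon> \<Longrightarrow> ennreal (K * r) \<le> emeasure slice_measure (eps_neighbourhood r B)) \<Longrightarrow>
       ennreal (K / 2) \<le> minkowski_quotient (CARD('n) - 2) B \<epsilon>"
    and minkowski_quotient_leI:
      "(\<And>r. 0 \<le> r \<Longrightarrow> r \<le> \<epsilon> \<Longrightarrow> emeasure slice_measure (eps_neighbourhood r B) \<le> ennreal (K * r)) \<Longrightarrow>
       minkowski_quotient (CARD('n) - 2) B \<epsilon> \<le> ennreal (K / 2)"
proof -
  have r: "0 \<le> sqrt (\<epsilon>\<^sup>2 - t\<^sup>2)" "sqrt (\<epsilon>\<^sup>2 - t\<^sup>2) \<le> \<epsilon>" if "t \<in> {-\<epsilon>..\<epsilon>}" for t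
    using that \<open>\<epsilon> > 0\<close> abs_le_square_iff[of t \<epsilon>] by (auto intro: real_le_lsqrt)
  have disc: "ennreal (K / 2) =
    (\<integral>\<^sup>+ t. ennreal (K * sqrt (\<epsilon>\<^sup>2 - t\<^sup>2)) * indicator {-\<epsilon>..\<epsilon>} t \<partial>lborel) / ennreal (pi * \<epsilon>\<^sup>2)"
  proof -
    have "(\<integral>\<^sup>+ t. ennreal (K * sqrt (\<epsilon>\<^sup>2 - t\<^sup>2)) * indicator {-\<epsilon>..\<epsilon>} t \<partial>lborel)
      = (\<integral>\<^sup>+ t. ennreal K * (ennreal (sqrt (\<epsilon>\<^sup>2 - t\<^sup>2)) * indicator {-\<epsilon>..\<epsilon>} t) \<partial>lborel)"
      using \<open>K \<ge> 0\<close> r by (intro nn_integral_cong) (simp add: indicator_def ennreal_mult)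
    also have "\<dots> = ennreal K * ennreal (pi * \<epsilon>\<^sup>2 / 2)"
      using \<open>\<epsilon> > 0\<close> by (subst nn_integral_cmult) (auto simp: nn_integral_half_disc)
    also have "\<dots> = ennreal (K / 2 * (pi * \<epsilon>\<^sup>2))"
      using \<open>K \<ge> 0\<close> by (subst ennreal_mult[symmetric]) auto
    finally show ?thesis
      using \<open>K \<ge> 0\<close> \<open>\<epsilon> > 0\<close> by (simp add: divide_ennreal)
  qed
  have quotient: "minkowski_quotient (CARD('n) - 2) B \<epsilon> =
    (\<integral>\<^sup>+ t. emeasure slice_measure (eps_neighbourhood (sqrt (\<epsilon>\<^sup>2 - t\<^sup>2)) B) * indicator {-\<epsilon>..\<epsilon>} t \<partial>lborel)
      / ennreal (pi * \<epsilon>\<^sup>2)"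
    using assms by (subst emeasure_eps_neighbourhood[symmetric]) (auto simp: minkowski_quotient_codim_2)
  show "ennreal (K / 2) \<le> minkowski_quotient (CARD('n) - 2) B \<epsilon>"
    if "\<And>r. 0 \<le> r \<Longrightarrow> r \<le> \<epsilon> \<Longrightarrow> ennreal (K * r) \<le> emeasure slice_measure (eps_neighbourhood r B)"
    unfolding quotient disc
    by (intro divide_right_mono_ennreal nn_integral_mono) (auto simp: indicator_def intro!: that r)
  show "minkowski_quotient (CARD('n) - 2) B \<epsilon> \<le> ennreal (K / 2)"
    if "\<And>r. 0 \<le> r \<Longrightarrow> r \<le> \<epsilon> \<Longrightarrow> emeasure slice_measure (eps_neighbourhood r B) \<le> ennreal (K * r)"
    unfolding quotient disc
    by (intro divide_right_mono_ennreal nn_integral_mono) (auto simp: indicator_def intro!: that r)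
qed

text \<open>The neighbourhood lies between two cylinders of height 2\<epsilon>, one over the simplex
  and one over a slightly enlarged simplex, whose measures agree in the limit. This identifies the
  content in the theorem with the slice measure.\<close>

lemma minkowski_content_simplex:
  "(minkowski_quotient (CARD('n) - 1) (simplex_Delta :: (real ^ 'n) set)
    \<longlongrightarrow> emeasure slice_measure (simplex_Delta :: (real ^ 'n) set)) (at_right 0)"
    (is "(?q \<longlongrightarrow> ?V) _")
proof -
  let ?D = "simplex_Delta :: (real ^ 'n) set"
  have H: "height x = 0" if "x \<in> ?D" for x
    using that by (simp add: simplex_Delta_def height_eq_0_iff)
  define N where "N = enn2real ?V"
  have N: "?V = ennreal N" "N \<ge> 0"
    using emeasure_slice_simplex_finite[where 'n = 'n] by (simp_all add: N_def)
  have q: "?q \<epsilon> = emeasure lebesgue (eps_neighbourhood \<epsilon> ?D) / ennreal (2 * \<epsilon>)" for \<epsilon>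
    by (simp add: minkowski_quotient_def)
  have lower: "ennreal N \<le> ?q \<epsilon>" if "\<epsilon> > 0" for \<epsilon>
  proof -
    have "ennreal (2 * \<epsilon> * N) = emeasure lborel {x. height x \<in> {-\<epsilon>..\<epsilon>} \<and> flat_proj x \<in> ?D}"
      using that N closed_simplex_Delta by (subst emeasure_cylinder) (auto simp: ennreal_mult)
    also have "\<dots> \<le> emeasure lborel (eps_neighbourhood \<epsilon> ?D)"
    proof (rule emeasure_mono)
      have "norm (flat_proj x - x) \<le> \<epsilon>" if "height x \<in> {-\<epsilon>..\<epsilon>}" for x :: "real ^ 'n"
        using that by (auto simp: flat_proj_def)
      then show "{x. height x \<in> {-\<epsilon>..\<epsilon>} \<and> flat_proj x \<in> ?D} \<subseteq> eps_neighbourhood \<epsilon> ?D"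
        by (auto simp: eps_neighbourhood_def)
    qed (simp add: eps_neighbourhood_borel compact_simplex_Delta)
    finally have "ennreal (2 * \<epsilon> * N) / ennreal (2 * \<epsilon>) \<le> ?q \<epsilon>"
      unfolding q by (intro divide_right_mono_ennreal)
        (simp add: emeasure_lebesgue_eps_neighbourhood compact_simplex_Delta)
    then show ?thesis
      using that N by (simp add: divide_ennreal)
  qed
  have upper: "?q \<epsilon> \<le> ennreal ((1 + real CARD('n) * \<epsilon>) ^ (CARD('n) - 1) * N)" if "\<epsilon> > 0" for \<epsilon>
  proof -
    \<comment> \<open>The ratio is chosen so that the coordinate bound of \<open>?T\<close> is
      exactly -\<epsilon>.\<close>
    let ?T = "scaled_simplex (1 + real CARD('n) * \<epsilon>) :: (real ^ 'n) set"
    have "emeasure lborel (eps_neighbourhood \<epsilon> ?D)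
      \<le> emeasure lborel {x. height x \<in> {-\<epsilon>..\<epsilon>} \<and> flat_proj x \<in> ?T}"
    proof (rule emeasure_mono)
      show "eps_neighbourhood \<epsilon> ?D \<subseteq> {x. height x \<in> {-\<epsilon>..\<epsilon>} \<and> flat_proj x \<in> ?T}"
      proof
        fix x assume "x \<in> eps_neighbourhood \<epsilon> ?D"
        then have "flat_proj x + height x *\<^sub>R diag \<in> eps_neighbourhood \<epsilon> ?D"
          by (simp add: flat_proj_def)
        then have *: "height x \<in> {-\<epsilon>..\<epsilon>}" "flat_proj x \<in> eps_neighbourhood (sqrt (\<epsilon>\<^sup>2 - (height x)\<^sup>2)) ?D"
          using eps_neighbourhood_slice[of ?D "flat_proj x" \<epsilon> "height x"] H \<open>\<epsilon> > 0\<close> by auto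
        then obtain b where b: "b \<in> ?D" "norm (b - flat_proj x) \<le> sqrt (\<epsilon>\<^sup>2 - (height x)\<^sup>2)"
          by (auto simp: eps_neighbourhood_def)
        have "sqrt (\<epsilon>\<^sup>2 - (height x)\<^sup>2) \<le> \<epsilon>"
          using \<open>\<epsilon> > 0\<close> by (auto intro: real_le_lsqrt)
        then have "- \<epsilon> \<le> flat_proj x $ i" for i
          using b component_le_norm_cart[of "b - flat_proj x" i] by (auto simp: simplex_Delta_def abs_le_iff dest: spec[of _ i])
        with * show "x \<in> {x. height x \<in> {-\<epsilon>..\<epsilon>} \<and> flat_proj x \<in> ?T}"
          by (auto simp: scaled_simplex_def)
      qed
    qed measurable
    also have "\<dots> = ennreal (2 * \<epsilon> * ((1 + real CARD('n) * \<epsilon>) ^ (CARD('n) - 1) * N))"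
      using that N by (subst emeasure_cylinder) (auto simp: emeasure_scaled_simplex add_pos_nonneg ennreal_mult)
    finally have "?q \<epsilon> \<le> ennreal (2 * \<epsilon> * ((1 + real CARD('n) * \<epsilon>) ^ (CARD('n) - 1) * N)) / ennreal (2 * \<epsilon>)"
      unfolding q by (intro divide_right_mono_ennreal)
        (simp add: emeasure_lebesgue_eps_neighbourhood compact_simplex_Delta)
    then show ?thesis
      using that N by (simp add: divide_ennreal)
  qed
  show ?thesis
    unfolding N(1)
  proof (rule tendsto_sandwich)
    show "\<forall>\<^sub>F \<epsilon> in at_right 0. ennreal N \<le> ?q \<epsilon>"
      using lower by (auto simp: eventually_at_filter)
    show "\<forall>\<^sub>F \<epsilon> in at_right 0. ?q \<epsilon> \<le> ennreal ((1 + real CARD('n) * \<epsilon>) ^ (CARD('n) - 1) * N)"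
      using upper by (auto simp: eventually_at_filter)
    have "((\<lambda>\<epsilon>. (1 + real CARD('n) * \<epsilon>) ^ (CARD('n) - 1) * N) \<longlongrightarrow> (1 + real CARD('n) * 0) ^ (CARD('n) - 1) * N) (at_right 0)"
      by (intro tendsto_intros)
    then show "((\<lambda>\<epsilon>. ennreal ((1 + real CARD('n) * \<epsilon>) ^ (CARD('n) - 1) * N)) \<longlongrightarrow> ennreal N) (at_right 0)"
      by simp
  qed simp
qed

section \<open>Packing translated parts\<close>

text \<open>The edge length of the simplex; the constant in the theorem owes its square root to
  it.\<close>

lemma norm_axis_diff: "i \<noteq> j \<Longrightarrow> norm (axis i 1 - axis j 1 :: real ^ 'n) = sqrt 2"
  by (simp add: norm_eq_sqrt_inner inner_diff_left inner_diff_right inner_axis_axis)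

lemma component_diff_le_norm:
  assumes "i \<noteq> j"
  shows "x $ i - x $ j \<le> sqrt 2 * norm (x :: real ^ 'n)"
proof -
  have "x $ i - x $ j = (axis i 1 - axis j 1) \<bullet> x"
    by (simp add: inner_diff_left inner_axis')
  also have "\<dots> \<le> norm (axis i 1 - axis j 1 :: real ^ 'n) * norm x"
    by (rule norm_cauchy_schwarz)
  finally show ?thesis by (simp add: norm_axis_diff assms)
qed

text \<open>Taking the vertex relative to the centre keeps the translations parallel to the
  hyperplane, while differences of two of these vectors are still edges of the simplex.\<close>

definition centre_minus_vertex :: "'n \<Rightarrow> real ^ 'n" where
  "centre_minus_vertex i = (\<chi> j. 1 / real CARD('n)) - axis i 1"

lemma centre_minus_vertex_diff:
  "centre_minus_vertex i - centre_minus_vertex j = axis j 1 - axis i 1"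
  by (simp add: centre_minus_vertex_def)

lemma centre_minus_vertex_inner_diag [simp]: "centre_minus_vertex i \<bullet> diag = 0"
  by (simp add: centre_minus_vertex_def inner_diag sum_subtractf axis_def)

lemma scaled_simplex_shift_iff:
  "x + s *\<^sub>R centre_minus_vertex i \<in> scaled_simplex a \<longleftrightarrow> height x = 0 \<and>
    (\<forall>j. (1 - a) / real CARD('n) \<le> x $ j + s / real CARD('n) - (if j = i then s else 0))"
  for x :: "real ^ 'n"
proof -
  have "(x + s *\<^sub>R centre_minus_vertex i) $ j = x $ j + s / real CARD('n) - (if j = i then s else 0)" for j
    by (simp add: centre_minus_vertex_def axis_def right_diff_distrib)
  then show ?thesis
    by (simp only: scaled_simplex_def mem_Collect_eq height_add inner_scaleR_left
        centre_minus_vertex_inner_diag mult_zero_right add_0_right)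
qed

text \<open>Subadditivity is applied before the translation and additivity after it: the sets
  \<open>S i\<close> may overlap, only their translates must be disjoint.\<close>

lemma slice_packing:
  fixes S :: "'n \<Rightarrow> (real ^ 'n) set" and v :: "'n \<Rightarrow> real ^ 'n"
  assumes S [measurable]: "\<And>i. S i \<in> sets borel" and T [measurable]: "T \<in> sets borel"
    and v: "\<And>i. v i \<bullet> diag = 0"
    and sub: "\<And>i x. x \<in> S i \<Longrightarrow> x + v i \<in> T"
    and disj: "\<And>i j x y. i \<noteq> j \<Longrightarrow> x \<in> S i \<Longrightarrow> y \<in> S j \<Longrightarrow> x + v i \<noteq> y + v j"
  shows "emeasure slice_measure (\<Union>i. S i) \<le> emeasure slice_measure T"
proof -
  \<comment> \<open>The translate of \<open>S i\<close> by \<open>v i\<close>, written as a preimage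
    so that measurability is immediate.\<close>
  define D where "D i = (\<lambda>x. x + (- v i)) -` S i" for i
  have D [measurable]: "D i \<in> sets borel" for i
    using measurable_sets_borel[of "\<lambda>x. x + (- v i)" borel "S i"] by (simp add: D_def)
  have "emeasure slice_measure (\<Union>i. S i) \<le> (\<Sum>i\<in>UNIV. emeasure slice_measure (S i))"
    by (rule emeasure_subadditive_finite) auto
  also have "\<dots> = (\<Sum>i\<in>UNIV. emeasure slice_measure (D i))"
    unfolding D_def using v by (subst emeasure_slice_measure_translate) auto
  also have "\<dots> = emeasure slice_measure (\<Union>i. D i)"
  proof (rule sum_emeasure)
    show "disjoint_family_on D UNIV"
      unfolding disjoint_family_on_def
    proof (intro ballI impI)
      fix i j :: 'n assume "i \<noteq> j"
      show "D i \<inter> D j = {}"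
      proof (rule ccontr)
        assume "D i \<inter> D j \<noteq> {}"
        then obtain z where "z - v i \<in> S i" "z - v j \<in> S j"
          by (auto simp: D_def)
        with disj[OF \<open>i \<noteq> j\<close> this] show False by simp
      qed
    qed
  qed auto
  also have "\<dots> \<le> emeasure slice_measure T"
  proof (rule emeasure_mono)
    show "(\<Union>i. D i) \<subseteq> T"
      using sub by (fastforce simp: D_def)
  qed auto
  finally show ?thesis .
qed

section \<open>Lower bound for admissible partitions\<close>

lemma
  assumes "sperner_admissible A"
  shows sperner_admissible_compact: "compact (A i)"
    and sperner_admissible_subset: "A i \<subseteq> simplex_Delta"
    and compact_separating_set: "compact (separating_set A)"
    and separating_set_subset: "separating_set A \<subseteq> simplex_Delta"
proof -
  show sub: "A i \<subseteq> simplex_Delta" for i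
    using assms by (auto simp: sperner_admissible_def)
  show comp: "compact (A i)" for i
    using compact_simplex_Delta assms sub[of i]
    by (metis compact_Int_closed inf.absorb_iff2 sperner_admissible_def)
  show "compact (separating_set A)"
    unfolding separating_set_def
    by (intro compact_UN) (auto intro!: compact_Int comp)
  show "separating_set A \<subseteq> simplex_Delta"
    using sub by (auto simp: separating_set_def)
qed

lemma height_simplex: "x \<in> simplex_Delta \<Longrightarrow> height x = 0"
  by (simp add: simplex_Delta_def height_eq_0_iff)

lemma convex_simplex_Delta: "convex simplex_Delta"
  by (auto simp: convex_def simplex_Delta_def sum.distrib sum_distrib_left[symmetric])

text \<open>The segment is connected and covered by two closed sets, \<open>A i\<close> and the
  union of the other parts, so they share a point \<open>b\<close> on it. As \<open>b\<close> splits
  the length of the segment, it is within half that length of one end.\<close>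

lemma separating_set_between:
  assumes A: "sperner_admissible A" and "x \<in> A i" "y \<in> A j" "i \<noteq> j"
  shows "\<exists>b \<in> separating_set A. norm (b - x) \<le> norm (x - y) / 2 \<or> norm (b - y) \<le> norm (x - y) / 2"
proof -
  let ?R = "\<Union>l\<in>-{i}. A l"
  have closed: "closed (A i)" "closed ?R"
    using A by (auto simp: sperner_admissible_def)
  have "closed_segment x y \<subseteq> simplex_Delta"
    using assms sperner_admissible_subset[OF A]
    by (intro closed_segment_subset convex_simplex_Delta) auto
  also have "\<dots> \<subseteq> A i \<union> ?R"
    using A by (auto simp: sperner_admissible_def)
  finally have cover: "closed_segment x y \<subseteq> A i \<union> ?R" .
  have "A i \<inter> closed_segment x y \<noteq> {}" "?R \<inter> closed_segment x y \<noteq> {}"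
    using assms by auto
  then have "A i \<inter> ?R \<inter> closed_segment x y \<noteq> {}"
    using connected_segment(1)[of x y] closed cover unfolding connected_closed by blast
  then obtain b where b: "b \<in> separating_set A" "b \<in> closed_segment x y"
    unfolding separating_set_def by fastforce
  from b(2) have "norm (x - y) = norm (b - x) + norm (b - y)"
    by (simp add: between_mem_segment[symmetric] between dist_norm norm_minus_commute)
  with b(1) show ?thesis
    by (intro bexI[of _ b]) auto
qed

lemma slice_measure_lower:
  fixes A :: "'n \<Rightarrow> (real ^ 'n) set"
  assumes A: "sperner_admissible A" and "r \<ge> 0" "sqrt 2 * r < 1"
    and pos: "\<And>i x. x \<in> A i \<Longrightarrow> sqrt 2 * r \<le> x $ i"
  shows "emeasure slice_measure (simplex_Delta :: (real ^ 'n) set) \<le>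
    emeasure slice_measure (eps_neighbourhood r (separating_set A)) +
    emeasure slice_measure (scaled_simplex (1 - sqrt 2 * r) :: (real ^ 'n) set)"
proof -
  let ?N = "eps_neighbourhood r (separating_set A)" and ?s = "sqrt 2 * r"
  have N [measurable]: "?N \<in> sets borel"
    by (intro eps_neighbourhood_borel compact_separating_set A)
  have AN: "A i - ?N \<in> sets borel" for i
    using A by (intro sets.Diff N borel_closed) (simp add: sperner_admissible_def)
  then have UN: "(\<Union>i. A i - ?N) \<in> sets borel"
    by (intro sets.finite_UN) auto
  have "emeasure slice_measure (simplex_Delta :: (real ^ 'n) set)
    \<le> emeasure slice_measure (?N \<union> (\<Union>i. A i - ?N))"
  proof (rule emeasure_mono)
    show "simplex_Delta \<subseteq> ?N \<union> (\<Union>i. A i - ?N)"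
      using A by (auto simp: sperner_admissible_def)
    show "?N \<union> (\<Union>i. A i - ?N) \<in> sets slice_measure"
      by (simp only: sets_slice_measure sets.Un N UN)
  qed
  also have "\<dots> \<le> emeasure slice_measure ?N + emeasure slice_measure (\<Union>i. A i - ?N)"
    by (intro emeasure_subadditive) (simp_all only: sets_slice_measure N UN)
  also have "emeasure slice_measure (\<Union>i. A i - ?N)
      \<le> emeasure slice_measure (scaled_simplex (1 - ?s) :: (real ^ 'n) set)"
  proof (rule slice_packing[where v = "\<lambda>i. ?s *\<^sub>R centre_minus_vertex i"])
    fix i x assume x: "x \<in> A i - ?N"
    then have "x \<in> simplex_Delta" using sperner_admissible_subset[OF A] by auto
    \<comment> \<open>The translation adds \<open>s / k\<close> to every coordinate and takes
      \<open>s\<close> from the \<open>i\<close>-th, which \<open>pos\<close> allows; so all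
      coordinates end up at least \<open>s / k\<close>, the bound defining the shrunken
      simplex.\<close>
    then show "x + ?s *\<^sub>R centre_minus_vertex i \<in> scaled_simplex (1 - ?s)"
      using pos[of x i] x
      by (auto simp: scaled_simplex_shift_iff height_simplex) (simp add: simplex_Delta_def)
  next
    fix i j x y assume ij: "i \<noteq> j" "x \<in> A i - ?N" "y \<in> A j - ?N"
    show "x + ?s *\<^sub>R centre_minus_vertex i \<noteq> y + ?s *\<^sub>R centre_minus_vertex j"
    proof
      assume "x + ?s *\<^sub>R centre_minus_vertex i = y + ?s *\<^sub>R centre_minus_vertex j"
      then have "x - y = ?s *\<^sub>R (centre_minus_vertex j - centre_minus_vertex i)"
        by (simp add: algebra_simps)
      \<comment> \<open>Here \<open>x - y\<close> is an edge scaled by \<open>sqrt 2 * r\<close>,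
        hence of length \<open>2 * r\<close>; the separating set then comes within \<open>r\<close>
        of \<open>x\<close> or \<open>y\<close>.\<close>
      then have "norm (x - y) / 2 = r"
        using \<open>r \<ge> 0\<close> ij(1) by (simp add: centre_minus_vertex_diff norm_axis_diff abs_mult)
      then have "x \<in> ?N \<or> y \<in> ?N"
        using separating_set_between[OF A, of x i y j] ij by (auto simp: eps_neighbourhood_def)
      with ij show False by simp
    qed
  qed (use AN in auto)
  finally show ?thesis by (simp add: add_left_mono)
qed

section \<open>The Voronoi partition\<close>

lemma Max_vec_eq_iff: "x $ i = (MAX j. x $ j) \<longleftrightarrow> (\<forall>j. x $ j \<le> x $ (i :: 'n::finite))"
  for x :: "real ^ 'n"
proof
  assume "\<forall>j. x $ j \<le> x $ i"
  then show "x $ i = (MAX j. x $ j)" by (intro Max_eqI[symmetric]) auto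
qed (metis Max_ge finite_class.finite finite_imageI rangeI)

lemma max_component: "\<exists>i. \<forall>j. (x :: real ^ 'n) $ j \<le> x $ i"
proof -
  have "(MAX j. x $ j) \<in> range (($) x)"
    by (rule Max_in) auto
  then obtain i where "(MAX j. x $ j) = x $ i"
    by (rule imageE)
  then show ?thesis
    using Max_vec_eq_iff[of x i] by auto
qed

lemma voronoi_iff: "x \<in> voronoi i \<longleftrightarrow> x \<in> simplex_Delta \<and> (\<forall>j. x $ j \<le> x $ i)"
  by (simp add: voronoi_def Max_vec_eq_iff)

lemma voronoi_pos:
  assumes "x \<in> voronoi i"
  shows "0 < x $ i"
proof (rule ccontr)
  assume "\<not> 0 < x $ i"
  with assms have "x $ j = 0" for j
    by (auto simp: voronoi_iff simplex_Delta_def intro!: antisym intro: order_trans)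
  with assms show False by (simp add: voronoi_iff simplex_Delta_def)
qed

text \<open>Moving \<open>x\<close> in the direction \<open>e\<^sub>j - e\<^sub>i\<close> leaves the \<open>i\<close>-th cell.\<close>

lemma voronoi_not_interior:
  assumes "x \<in> voronoi i" "x \<in> voronoi j" "i \<noteq> j"
  shows "x \<notin> top_of_set simplex_Delta interior_of voronoi i"
proof
  assume "x \<in> top_of_set simplex_Delta interior_of voronoi i"
  then obtain T where "openin (top_of_set simplex_Delta) T" "x \<in> T" "T \<subseteq> voronoi i"
    by (auto simp: interior_of_def)
  then obtain e where e: "e > 0" "ball x e \<inter> simplex_Delta \<subseteq> voronoi i"
    by (meson openin_contains_ball subset_trans)
  \<comment> \<open>The bound \<open>x $ i\<close> keeps \<open>y\<close> nonnegative; the bound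
    \<open>e / 2\<close> keeps it in the ball, because
    \<open>d * sqrt 2 < d * 2 \<le> e\<close>.\<close>
  define d where "d = min (e / 2) (x $ i)"
  have d: "d > 0" "d \<le> x $ i" "d * 2 \<le> e"
    using e voronoi_pos[OF assms(1)] by (auto simp: d_def)
  define y where "y = x + d *\<^sub>R (axis j 1 - axis i 1)"
  have comp: "y $ l = x $ l + d * ((if l = j then 1 else 0) - (if l = i then 1 else 0))" for l
    by (simp add: y_def axis_def)
  have "dist x y = d * sqrt 2"
    using norm_axis_diff[of i j] d assms(3) by (simp add: y_def dist_norm norm_minus_commute norm_axis_diff)
  then have "y \<in> ball x e"
    using d(3) mult_strict_left_mono[OF sqrt2_less_2 d(1)] by (simp only: mem_ball)
  moreover have "y \<in> simplex_Delta"
    using assms d by (auto simp: simplex_Delta_def voronoi_iff comp sum.distrib sum_subtractf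
        sum_distrib_left[symmetric])
  ultimately have "y \<in> voronoi i" using e by auto
  then have "y $ j \<le> y $ i" by (simp add: voronoi_iff)
  moreover have "x $ j = x $ i"
    using assms by (auto simp: voronoi_iff intro!: antisym)
  ultimately show False using d(1) assms(3) by (simp add: comp)
qed

lemma sperner_admissible_voronoi: "sperner_admissible (voronoi :: 'n \<Rightarrow> (real ^ 'n) set)"
  unfolding sperner_admissible_def
proof (intro conjI allI impI ballI)
  have "voronoi i = simplex_Delta \<inter> (\<Inter>j. {x :: real ^ 'n. x $ j \<le> x $ i})" for i
    by (auto simp: voronoi_iff)
  then show closed: "closed (voronoi i :: (real ^ 'n) set)" for i
    by (auto intro!: closed_Int closed_INT closed_simplex_Delta closed_Collect_le continuous_intros)
  show "(\<Union>i. voronoi i) = (simplex_Delta :: (real ^ 'n) set)"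
    using max_component by (auto simp: voronoi_iff)
  have frontier: "x \<in> top_of_set simplex_Delta frontier_of voronoi i"
    if "x \<in> voronoi i" "x \<in> voronoi j" "i \<noteq> j" for x :: "real ^ 'n" and i j
    using that voronoi_not_interior[OF that] closure_of_subset[of "voronoi i" "top_of_set simplex_Delta"]
    by (auto simp: frontier_of_def voronoi_iff subset_iff)
  show "voronoi i \<inter> voronoi j \<subseteq> (top_of_set simplex_Delta frontier_of voronoi i)
      \<inter> (top_of_set simplex_Delta frontier_of voronoi j)" if "i \<noteq> j" for i j :: 'n
    using frontier that by blast
  show "0 < x $ i" if "x \<in> voronoi i" for i and x :: "real ^ 'n"
    using that by (rule voronoi_pos)
qed

section \<open>Upper bound for the Voronoi partition\<close>

lemma slice_measure_tie:
  assumes "i \<noteq> j"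
  shows "emeasure slice_measure {x :: real ^ 'n. x $ i = x $ j} = 0"
proof -
  have "{x :: real ^ 'n. x $ i = x $ j} = {x. (axis i 1 - axis j 1) \<bullet> x = 0}"
    by (auto simp: inner_diff_left inner_axis')
  moreover have "axis i 1 - axis j 1 \<noteq> (0 :: real ^ 'n)"
    using norm_axis_diff[OF assms] by auto
  ultimately have null: "negligible {x :: real ^ 'n. x $ i = x $ j}"
    by (simp add: negligible_hyperplane)
  have meas [measurable]: "{x :: real ^ 'n. x $ i = x $ j} \<in> sets borel"
    by measurable
  \<comment> \<open>\<open>flat_proj\<close> subtracts the same number from all coordinates, so the
    cylinder over the tie set stays inside the tie set, which is a null hyperplane.\<close>
  have "emeasure slice_measure {x :: real ^ 'n. x $ i = x $ j} \<le> emeasure lborel {x :: real ^ 'n. x $ i = x $ j}"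
    unfolding emeasure_slice_measure[OF meas]
    by (rule emeasure_mono) (auto simp: flat_proj_def diag_def)
  also have "\<dots> = 0"
    using null meas negligible_iff_emeasure0[of "{x :: real ^ 'n. x $ i = x $ j}"] by auto
  finally show ?thesis by simp
qed

text \<open>Of the two cells that meet at \<open>b\<close>, at least one has an index other than
  \<open>i\<close>, and its coordinate is maximal.\<close>

lemma separating_set_voronoi_tie:
  assumes "b \<in> separating_set voronoi"
  shows "\<exists>j. j \<noteq> i \<and> b $ i \<le> b $ j"
proof -
  obtain l l' where "l \<noteq> l'" "b \<in> voronoi l" "b \<in> voronoi l'"
    using assms by (auto simp: separating_set_def)
  moreover have "l \<noteq> i \<or> l' \<noteq> i"
    using \<open>l \<noteq> l'\<close> by auto
  ultimately show ?thesis
    by (auto simp: voronoi_iff)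
qed

text \<open>Reversing the translations of the lower bound pulls the cells apart: coordinate
  \<open>i\<close> of the moved \<open>i\<close>-th cell exceeds every other by more than
  \<open>sqrt 2 * r\<close>. The moved cells are thus disjoint and leave the whole neighbourhood of
  the separating set free.\<close>

lemma slice_measure_voronoi_upper:
  fixes V :: "(real ^ 'n) set"
  defines "V \<equiv> separating_set voronoi"
  assumes "r \<ge> 0"
  shows "emeasure slice_measure (eps_neighbourhood r V)
      + emeasure slice_measure (scaled_simplex (1 + real CARD('n) * r - sqrt 2 * r) :: (real ^ 'n) set)
    \<le> emeasure slice_measure (scaled_simplex (1 + real CARD('n) * r) :: (real ^ 'n) set)"
proof -
  let ?k = "real CARD('n)" and ?s = "sqrt 2 * r"
  let ?N = "eps_neighbourhood r V" and ?T = "scaled_simplex (1 + ?k * r) :: (real ^ 'n) set"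
    and ?T' = "scaled_simplex (1 + ?k * r - ?s) :: (real ^ 'n) set"
  \<comment> \<open>Strict inequalities make the gap below strict; the ties that are left out are
    collected in the null set \<open>Z\<close>.\<close>
  define W where "W i = ?T' \<inter> {x. \<forall>j. j \<noteq> i \<longrightarrow> x $ j < x $ i}" for i
  have gap: "(x + - ?s *\<^sub>R centre_minus_vertex i) $ i - (x + - ?s *\<^sub>R centre_minus_vertex i) $ j > ?s"
    if "x \<in> W i" "j \<noteq> i" for x i j
    using that by (auto simp: W_def centre_minus_vertex_def axis_def algebra_simps)
  define Z where "Z = (\<Union>(i, j)\<in>{(i, j). i \<noteq> j}. {x :: real ^ 'n. x $ i = x $ j})"
  have N [measurable]: "?N \<in> sets borel"
    unfolding V_def by (intro eps_neighbourhood_borel compact_separating_set sperner_admissible_voronoi)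
  have W: "W i \<in> sets borel" for i unfolding W_def by measurable
  have tie: "{x :: real ^ 'n. x $ i = x $ j} \<in> sets borel" for i j by measurable
  then have Z: "Z \<in> sets borel" unfolding Z_def by auto
  have "Z \<in> null_sets slice_measure"
    unfolding Z_def using tie slice_measure_tie
    by (intro null_sets_UN') (auto intro!: null_setsI)
  then have "emeasure slice_measure Z = 0" by auto
  have "?T' \<subseteq> (\<Union>i. W i) \<union> Z"
  proof
    fix x :: "real ^ 'n" assume x: "x \<in> ?T'"
    obtain i where i: "\<And>j. x $ j \<le> x $ i"
      using max_component[of x] by blast
    show "x \<in> (\<Union>i. W i) \<union> Z"
    proof (cases "\<exists>j. j \<noteq> i \<and> x $ j = x $ i")
      case True
      then show ?thesis by (auto simp: Z_def)
    next
      case False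
      then have "x \<in> W i" using x i by (auto simp: W_def less_le)
      then show ?thesis by blast
    qed
  qed
  then have "emeasure slice_measure ?T' \<le> emeasure slice_measure (\<Union>i. W i) + emeasure slice_measure Z"
    using W Z by (intro order_trans[OF emeasure_mono emeasure_subadditive]) auto
  also have "\<dots> = emeasure slice_measure (\<Union>i. W i)"
    using \<open>emeasure slice_measure Z = 0\<close> by simp
  also have "\<dots> \<le> emeasure slice_measure (?T - ?N)"
  proof (rule slice_packing[where v = "\<lambda>i. - ?s *\<^sub>R centre_minus_vertex i"])
    fix i x assume x: "x \<in> W i"
    let ?y = "x + - ?s *\<^sub>R centre_minus_vertex i"
    \<comment> \<open>Each coordinate loses at most \<open>s / k\<close>, exactly the difference
      between the coordinate bounds of \<open>?T'\<close> and \<open>?T\<close>.\<close>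
    have "?y \<in> ?T"
      unfolding scaled_simplex_shift_iff
    proof (intro conjI allI)
      have x': "x \<in> ?T'" using x by (simp add: W_def)
      then show "height x = 0" by (simp add: scaled_simplex_def)
      fix j
      have "(1 - (1 + ?k * r - ?s)) / ?k \<le> x $ j"
        using x' by (simp only: scaled_simplex_def mem_Collect_eq)
      then show "(1 - (1 + ?k * r)) / ?k \<le> x $ j + - ?s / ?k - (if j = i then - ?s else 0)"
        using mult_nonneg_nonneg[OF real_sqrt_ge_zero[of 2] \<open>r \<ge> 0\<close>]
        by (auto simp: diff_divide_distrib)
    qed
    moreover have "?y \<notin> ?N"
    proof
      assume "?y \<in> ?N"
      then obtain b where b: "b \<in> V" "norm (b - ?y) \<le> r" by (auto simp: eps_neighbourhood_def)
      then obtain j where j: "j \<noteq> i" "b $ i \<le> b $ j"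
        using separating_set_voronoi_tie[of b i] by (auto simp: V_def)
      \<comment> \<open>Since \<open>b\<close> has no positive gap between \<open>i\<close> and
        \<open>j\<close>, the gap of \<open>?y\<close> is at most that of \<open>?y - b\<close>,
        which Cauchy-Schwarz bounds by \<open>sqrt 2 * r\<close>.\<close>
      have "?y $ i - ?y $ j \<le> (?y - b) $ i - (?y - b) $ j"
        using j by simp
      also have "\<dots> \<le> sqrt 2 * norm (?y - b)"
        using j by (intro component_diff_le_norm) auto
      also have "\<dots> \<le> ?s"
        using b by (simp add: norm_minus_commute)
      finally show False using gap[OF x j(1)] by simp
    qed
    ultimately show "?y \<in> ?T - ?N" by simp
  next
    fix i j x y assume ij: "i \<noteq> j" and x: "x \<in> W i" and y: "y \<in> W j"
    have "?s \<ge> 0" using \<open>r \<ge> 0\<close> by simp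
    show "x + - ?s *\<^sub>R centre_minus_vertex i \<noteq> y + - ?s *\<^sub>R centre_minus_vertex j"
    proof
      assume eq: "x + - ?s *\<^sub>R centre_minus_vertex i = y + - ?s *\<^sub>R centre_minus_vertex j"
      \<comment> \<open>At a common point, coordinate \<open>i\<close> would exceed coordinate
        \<open>j\<close> and conversely.\<close>
      show False
        using gap[OF y ij] gap[OF x ij[symmetric], unfolded eq] \<open>?s \<ge> 0\<close> by linarith
    qed
  qed (use W in auto)
  finally have T': "emeasure slice_measure ?T' \<le> emeasure slice_measure (?T - ?N)" .
  \<comment> \<open>On the hyperplane the neighbourhood has coordinates at least \<open>- r\<close>,
    which is the condition defining \<open>?T\<close>.\<close>
  have "emeasure slice_measure ?N \<le> emeasure slice_measure (?T \<inter> ?N)"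
  proof (rule emeasure_slice_measure_mono)
    fix x assume x: "height x = 0" "x \<in> ?N"
    then obtain b where b: "b \<in> V" "norm (b - x) \<le> r" by (auto simp: eps_neighbourhood_def)
    have "- r \<le> x $ i" for i
    proof -
      have "b \<in> simplex_Delta"
        using b(1) separating_set_subset[OF sperner_admissible_voronoi] by (auto simp: V_def)
      then have "0 \<le> b $ i" by (simp add: simplex_Delta_def)
      then show ?thesis
        using b(2) component_le_norm_cart[of "b - x" i] by (simp add: abs_le_iff)
    qed
    with x show "x \<in> ?T \<inter> ?N" by (auto simp: scaled_simplex_def)
  qed auto
  then have "emeasure slice_measure ?N + emeasure slice_measure ?T'
      \<le> emeasure slice_measure (?T \<inter> ?N) + emeasure slice_measure (?T - ?N)"
    using T' by (rule add_mono)
  also have "\<dots> = emeasure slice_measure ((?T \<inter> ?N) \<union> (?T - ?N))"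
    by (rule plus_emeasure) auto
  also have "(?T \<inter> ?N) \<union> (?T - ?N) = ?T" by blast
  finally show ?thesis .
qed

section \<open>Comparing the contents\<close>

text \<open>In \<open>1 - q^m = (1 - q) * (1 + ... + q^(m-1))\<close> each of the \<open>m\<close>
  summands is at least \<open>q^m\<close>. With \<open>q = 1 - s\<close> this bounds the measure
  lost by shrinking the simplex.\<close>

lemma one_minus_power_ge:
  assumes "0 \<le> q" "q \<le> (1 :: real)"
  shows "real m * (1 - q) * q ^ m \<le> 1 - q ^ m"
proof (induction m)
  case (Suc m)
  have "real (Suc m) * (1 - q) * q ^ Suc m \<le> real (Suc m) * (1 - q) * q ^ m"
    using assms by (intro mult_left_mono power_decreasing) auto
  also have "\<dots> = real m * (1 - q) * q ^ m + (1 - q) * q ^ m"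
    by (simp add: algebra_simps)
  also have "\<dots> \<le> (1 - q ^ m) + (1 - q) * q ^ m"
    using Suc by simp
  also have "\<dots> = 1 - q ^ Suc m"
    by (simp add: algebra_simps)
  finally show ?case .
qed simp

text \<open>The difference is \<open>s\<close> times a sum of \<open>m\<close> products, each at
  most \<open>p^(m-1)\<close>, hence at most \<open>p^m\<close> as \<open>1 \<le> p\<close>.\<close>

lemma power_diff_le:
  assumes "1 \<le> p" "0 \<le> s" "s \<le> (p :: real)"
  shows "p ^ m - (p - s) ^ m \<le> real m * s * p ^ m"
proof (induction m)
  case (Suc m)
  have "p ^ Suc m - (p - s) ^ Suc m = p * (p ^ m - (p - s) ^ m) + s * (p - s) ^ m"
    by (simp add: algebra_simps)
  also have "\<dots> \<le> p * (real m * s * p ^ m) + s * p ^ Suc m"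
  proof (intro add_mono mult_left_mono Suc)
    have "(p - s) ^ m \<le> p ^ m"
      using assms by (intro power_mono) auto
    also have "\<dots> \<le> p ^ Suc m"
      using assms by (intro power_increasing) auto
    finally show "(p - s) ^ m \<le> p ^ Suc m" .
  qed (use assms in auto)
  also have "\<dots> = real (Suc m) * s * p ^ Suc m"
    by (simp add: algebra_simps)
  finally show ?case .
qed simp

theorem theorem1:
  assumes "CARD('n::finite) \<ge> 2"
  shows "minkowski_content_exists (CARD('n) - 1) (simplex_Delta :: (real ^ 'n) set) \<and>
    (\<forall>A :: 'n \<Rightarrow> (real ^ 'n) set. sperner_admissible A \<longrightarrow>
       lower_minkowski_content (CARD('n) - 2) (separating_set A)
         \<ge> ennreal ((real CARD('n) - 1) / sqrt 2)
             * minkowski_content (CARD('n) - 1) (simplex_Delta :: (real ^ 'n) set)) \<and>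
    sperner_admissible (voronoi :: 'n \<Rightarrow> (real ^ 'n) set) \<and>
    lower_minkowski_content (CARD('n) - 2) (separating_set (voronoi :: 'n \<Rightarrow> (real ^ 'n) set))
      = ennreal ((real CARD('n) - 1) / sqrt 2)
          * minkowski_content (CARD('n) - 1) (simplex_Delta :: (real ^ 'n) set)"
proof -
  let ?D = "simplex_Delta :: (real ^ 'n) set" and ?k = "real CARD('n)"
  define m where "m = CARD('n) - 1"
  have m: "real m = ?k - 1" using assms by (simp add: m_def)
  define N where "N = enn2real (emeasure slice_measure ?D)"
  have N: "emeasure slice_measure ?D = ennreal N" "N \<ge> 0"
    using emeasure_slice_simplex_finite[where 'n = 'n] by (simp_all add: N_def)
  have scaled: "emeasure slice_measure (scaled_simplex a :: (real ^ 'n) set) = ennreal (a ^ m * N)"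
    if "a > 0" for a
    using that N by (simp add: emeasure_scaled_simplex m_def ennreal_mult)
  have content: "minkowski_content (CARD('n) - 1) ?D = ennreal N"
    unfolding minkowski_content_def N(1)[symmetric]
    by (rule tendsto_Lim[OF _ minkowski_content_simplex]) simp
  \<comment> \<open>The constant is brought to the form \<open>K / 2\<close> that the quotient
    bounds produce.\<close>
  have goal: "ennreal ((?k - 1) / sqrt 2) * minkowski_content (CARD('n) - 1) ?D
      = ennreal (real m * sqrt 2 * N / 2)"
  proof -
    have "real m / sqrt 2 * N = real m * sqrt 2 * N / 2"
      by (simp add: field_simps)
    then show ?thesis
      unfolding content m[symmetric] using N(2) by (simp add: ennreal_mult[symmetric])
  qed
  have lower: "ennreal (real m * sqrt 2 * N / 2) \<le> lower_minkowski_content (CARD('n) - 2) (separating_set A)"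
    if A: "sperner_admissible A" for A :: "'n \<Rightarrow> (real ^ 'n) set"
  proof -
    note B = compact_separating_set[OF A] height_simplex[OF subsetD[OF separating_set_subset[OF A]]]
    \<comment> \<open>The factor \<open>(1 - s) ^ m\<close> decreases in \<open>r\<close>, so its
      value at \<open>r = \<epsilon>\<close> serves for all smaller radii and makes the slice bound
      linear in \<open>r\<close>.\<close>
    let ?f = "\<lambda>\<epsilon>. real m * sqrt 2 * (1 - sqrt 2 * \<epsilon>) ^ m * N / 2"
    \<comment> \<open>Compactness turns positivity of the \<open>i\<close>-th coordinate on
      \<open>A i\<close> into a uniform bound; for an empty part any constant will do.\<close>
    have "\<exists>c>0. \<forall>x\<in>A i. c \<le> x $ i" for i
    proof (cases "A i = {}")
      case False
      have "continuous_on (A i) (\<lambda>x. x $ i)" by (intro continuous_intros)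
      then obtain x where "x \<in> A i" "\<forall>y\<in>A i. x $ i \<le> y $ i"
        using continuous_attains_inf[OF sperner_admissible_compact[OF A] False] by blast
      moreover have "x $ i > 0" using A \<open>x \<in> A i\<close> by (simp add: sperner_admissible_def)
      ultimately show ?thesis by blast
    qed (auto intro: exI[of _ 1])
    then obtain c where c: "\<And>i. c i > 0" "\<And>i x. x \<in> A i \<Longrightarrow> c i \<le> x $ i"
      by metis
    \<comment> \<open>The cap \<open>1 / 2\<close> ensures \<open>s < 1\<close>, so that the
      shrunken simplex has a positive ratio.\<close>
    define c0 where "c0 = min (1 / 2) (Min (range c))"
    have c0: "c0 > 0" "c0 < 1" "\<And>i. c0 \<le> c i"
      using c(1) by (auto simp: c0_def Min_gr_iff min.coboundedI2)
    have "ennreal (?f \<epsilon>) \<le> minkowski_quotient (CARD('n) - 2) (separating_set A) \<epsilon>"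
      if \<epsilon>: "\<epsilon> > 0" "sqrt 2 * \<epsilon> \<le> c0" for \<epsilon>
    proof (rule minkowski_quotient_geI[OF assms B \<epsilon>(1)])
      show "0 \<le> real m * sqrt 2 * (1 - sqrt 2 * \<epsilon>) ^ m * N"
        using \<epsilon> c0 N by simp
      fix r assume r: "0 \<le> r" "r \<le> \<epsilon>"
      define s where "s = sqrt 2 * r"
      have s: "0 \<le> s" "s \<le> sqrt 2 * \<epsilon>" using r by (auto simp: s_def)
      then have "s \<le> c0" "s < 1" using \<epsilon> c0 by auto
      have "real m * sqrt 2 * (1 - sqrt 2 * \<epsilon>) ^ m * N * r = real m * s * (1 - sqrt 2 * \<epsilon>) ^ m * N"
        by (simp add: s_def)
      also have "\<dots> \<le> real m * s * (1 - s) ^ m * N"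
        using s \<epsilon> c0 N by (intro mult_right_mono mult_left_mono power_mono) auto
      also have "\<dots> \<le> (1 - (1 - s) ^ m) * N"
        using one_minus_power_ge[of "1 - s" m] s \<open>s < 1\<close> N by (intro mult_right_mono) auto
      finally have le: "real m * sqrt 2 * (1 - sqrt 2 * \<epsilon>) ^ m * N * r \<le> N - (1 - s) ^ m * N"
        by (simp add: algebra_simps)
      have "ennreal N \<le> emeasure slice_measure (eps_neighbourhood r (separating_set A))
        + ennreal ((1 - s) ^ m * N)"
      proof -
        have "sqrt 2 * r \<le> x $ i" if "x \<in> A i" for x i
          using c(2)[OF that] c0(3)[of i] \<open>s \<le> c0\<close> by (simp add: s_def)
        then show ?thesis
          using slice_measure_lower[OF A r(1)] \<open>s < 1\<close> scaled[of "1 - s"] N(1) by (simp add: s_def)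
      qed
      then have "ennreal (N - (1 - s) ^ m * N)
          \<le> emeasure slice_measure (eps_neighbourhood r (separating_set A))"
        using N(2) \<open>s < 1\<close> by (subst ennreal_minus[symmetric]) (auto simp: ennreal_minus_le_iff add.commute)
      with le show "ennreal (real m * sqrt 2 * (1 - sqrt 2 * \<epsilon>) ^ m * N * r)
          \<le> emeasure slice_measure (eps_neighbourhood r (separating_set A))"
        using ennreal_leI order_trans by blast
    qed
    moreover have "\<forall>\<^sub>F \<epsilon> in at_right 0. sqrt 2 * \<epsilon> < c0 \<and> (0 :: real) < \<epsilon>"
    proof -
      have "((\<lambda>\<epsilon>. sqrt 2 * \<epsilon>) \<longlongrightarrow> sqrt 2 * 0) (at_right 0)" by (intro tendsto_intros)
      then have "\<forall>\<^sub>F \<epsilon> in at_right 0. sqrt 2 * \<epsilon> < c0"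
        using c0(1) by (intro order_tendstoD) auto
      then show ?thesis
        by (rule eventually_conj) (simp add: eventually_at_filter)
    qed
    ultimately have "\<forall>\<^sub>F \<epsilon> in at_right 0.
        ennreal (?f \<epsilon>) \<le> minkowski_quotient (CARD('n) - 2) (separating_set A) \<epsilon>"
      by (auto elim!: eventually_mono)
    then have "Liminf (at_right 0) (\<lambda>\<epsilon>. ennreal (?f \<epsilon>))
        \<le> lower_minkowski_content (CARD('n) - 2) (separating_set A)"
      unfolding lower_minkowski_content_def by (rule Liminf_mono)
    moreover have "(?f \<longlongrightarrow> real m * sqrt 2 * (1 - sqrt 2 * 0) ^ m * N / 2) (at_right 0)"
      by (intro tendsto_intros) simp
    then have "((\<lambda>\<epsilon>. ennreal (?f \<epsilon>)) \<longlongrightarrow> ennreal (real m * sqrt 2 * N / 2)) (at_right 0)"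
      by (intro tendsto_ennrealI) simp
    then have "Liminf (at_right 0) (\<lambda>\<epsilon>. ennreal (?f \<epsilon>)) = ennreal (real m * sqrt 2 * N / 2)"
      by (intro lim_imp_Liminf) auto
    ultimately show ?thesis by simp
  qed
  have upper: "lower_minkowski_content (CARD('n) - 2) (separating_set (voronoi :: 'n \<Rightarrow> (real ^ 'n) set))
      \<le> ennreal (real m * sqrt 2 * N / 2)"
  proof -
    let ?V = "separating_set (voronoi :: 'n \<Rightarrow> (real ^ 'n) set)"
    note A = sperner_admissible_voronoi[where 'n = 'n]
    note B = compact_separating_set[OF A] height_simplex[OF subsetD[OF separating_set_subset[OF A]]]
    \<comment> \<open>Now the factor \<open>p ^ m\<close> increases in \<open>r\<close>, so again
      its value at \<open>r = \<epsilon>\<close> works for all smaller radii.\<close>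
    let ?f = "\<lambda>\<epsilon>. real m * sqrt 2 * (1 + ?k * \<epsilon>) ^ m * N / 2"
    have "minkowski_quotient (CARD('n) - 2) ?V \<epsilon> \<le> ennreal (?f \<epsilon>)" if \<epsilon>: "\<epsilon> > 0" for \<epsilon>
    proof (rule minkowski_quotient_leI[OF assms B \<epsilon>(1)])
      show "0 \<le> real m * sqrt 2 * (1 + ?k * \<epsilon>) ^ m * N"
        using \<epsilon> N by simp
      fix r assume r: "0 \<le> r" "r \<le> \<epsilon>"
      define s p where "s = sqrt 2 * r" and "p = 1 + ?k * r"
      \<comment> \<open>This uses \<open>sqrt 2 < 2 \<le> k\<close> and keeps the ratio
        \<open>p - s\<close> at least 1, hence positive.\<close>
      have "s \<le> ?k * r"
        unfolding s_def using assms r sqrt2_less_2 by (intro mult_right_mono) auto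
      then have s: "0 \<le> s" "s \<le> p" "p - s > 0" "1 \<le> p" using r by (auto simp: s_def p_def)
      have "emeasure slice_measure (eps_neighbourhood r ?V) + ennreal ((p - s) ^ m * N) \<le> ennreal (p ^ m * N)"
        using slice_measure_voronoi_upper[OF r(1), where 'n = 'n] scaled[of "p - s"] scaled[of p] s
        by (simp add: s_def p_def)
      then have "emeasure slice_measure (eps_neighbourhood r ?V) \<le> ennreal (p ^ m * N) - ennreal ((p - s) ^ m * N)"
        by (subst ennreal_le_minus_iff) (auto simp: add.commute)
      also have "\<dots> = ennreal (p ^ m * N - (p - s) ^ m * N)"
        using s N by (intro ennreal_minus) auto
      also have "p ^ m * N - (p - s) ^ m * N \<le> real m * s * p ^ m * N"
        using mult_right_mono[OF power_diff_le[OF s(4,1,2), of m] N(2)] by (simp add: algebra_simps)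
      also have "\<dots> \<le> real m * s * (1 + ?k * \<epsilon>) ^ m * N"
        using s r N by (intro mult_right_mono mult_left_mono power_mono) (auto simp: p_def mult_left_mono)
      also have "\<dots> = real m * sqrt 2 * (1 + ?k * \<epsilon>) ^ m * N * r"
        by (simp add: s_def)
      finally show "emeasure slice_measure (eps_neighbourhood r ?V)
          \<le> ennreal (real m * sqrt 2 * (1 + ?k * \<epsilon>) ^ m * N * r)"
        by (simp add: ennreal_leI)
    qed
    then have "\<forall>\<^sub>F \<epsilon> in at_right 0. minkowski_quotient (CARD('n) - 2) ?V \<epsilon> \<le> ennreal (?f \<epsilon>)"
      by (simp add: eventually_at_filter)
    then have "lower_minkowski_content (CARD('n) - 2) ?V \<le> Liminf (at_right 0) (\<lambda>\<epsilon>. ennreal (?f \<epsilon>))"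
      unfolding lower_minkowski_content_def by (rule Liminf_mono)
    moreover have "(?f \<longlongrightarrow> real m * sqrt 2 * (1 + ?k * 0) ^ m * N / 2) (at_right 0)"
      by (intro tendsto_intros) simp
    then have "((\<lambda>\<epsilon>. ennreal (?f \<epsilon>)) \<longlongrightarrow> ennreal (real m * sqrt 2 * N / 2)) (at_right 0)"
      by (intro tendsto_ennrealI) simp
    then have "Liminf (at_right 0) (\<lambda>\<epsilon>. ennreal (?f \<epsilon>)) = ennreal (real m * sqrt 2 * N / 2)"
      by (intro lim_imp_Liminf) auto
    ultimately show ?thesis by simp
  qed
  show ?thesis
    unfolding goal
    using lower upper sperner_admissible_voronoi[where 'n = 'n] minkowski_content_simplex[where 'n = 'n]
    by (auto simp: minkowski_content_exists_def intro!: antisym)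
qed

end
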